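(* Let $c=1.4616321\ldots$ be the only positive root of the psi function $\psi$ on $(0,\infty)$. For $x\in(c,\infty)$ and $a\in\bigl(\frac12,e^{-\gamma}\bigr)$, the following conclusions are valid: (1) The errors $E_a(x)$ are uniformly bounded between $-\ln\frac{c+e^{-\gamma}}{c+1/2}$ and $\ln\frac{c+e^{-\gamma}}{c+1/2}$, that is, $$-\ln\frac{c+e^{-\gamma}}{c+1/2}\le E_a(x)\le\ln\frac{c+e^{-\gamma}}{c+1/2}$$ for all such $x$ and $a$. (2) $\psi(x)=\ln(x+a)-\frac1x+O\Bigl(\ln\frac{x+e^{-\gamma}}{x+1/2}\Bigr)$, where the implied constant is independent of $x\in(c,\infty)$ and $a\in\bigl(\frac12,e^{-\gamma}\bigr)$.
   Context: $\Gamma(x)=\int_0^\infty e^{-t}t^{x-1}\,dt$ for $x>0$ is Euler's gamma function, and $\psi(x)=\frac{d}{dx}\ln\Gamma(x)=\Gamma'(x)/\Gamma(x)$ for $x>0$ is the psi (digamma) function; it has exactly one zero on $(0,\infty)$. $\gamma=0.577\ldots$ is the Euler–Mascheroni constant, so $e^{-\gamma}=0.56\ldots$. For $a\in[0,1]$ and $x>0$, $I_a(x)=\ln(x+a)-\frac1x$, and the error of the approximation $\psi(x)\approx I_a(x)$ is $E_a(x)=\psi(x)-I_a(x)=\psi(x)-\ln(x+a)+\frac1x$. *)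

theory Defs
  imports "HOL-Analysis.Analysis"
begin

text \<open>
  The psi function is the library's \<^const>\<open>Polygamma\<close> of order 0, abbreviated \<open>Digamma\<close>.
  The library introduces it by a series; on the positive reals it is the derivative of
  \<open>ln \<circ> Gamma\<close> (and \<open>Gamma\<close> is Euler's integral there, by \<open>Gamma_integral_real\<close>).
\<close>

lemma ln_Gamma_has_derivative_Digamma:
  fixes x :: real
  assumes "x > 0"
  shows "((\<lambda>t. ln (Gamma t)) has_field_derivative Digamma x) (at x)"
proof (rule has_field_derivative_transform_within_open)
  show "(ln_Gamma has_field_derivative Digamma x) (at x)"
    using assms by (rule has_field_derivative_ln_Gamma_real)
  show "open {0::real<..}" "x \<in> {0<..}"
    using assms by simp_all
  show "ln_Gamma t = ln (Gamma t)" if "t \<in> {0<..}" for t :: real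
    using that by (simp add: ln_Gamma_real_pos)
qed

lemma ex1_Digamma_pos_root: "\<exists>!c::real. c > 0 \<and> Digamma c = 0"
proof (rule ex_ex1I)
  have "Digamma (2::real) = 1 - euler_mascheroni"
    using Digamma_plus1[of "1::real"] by simp
  then have "Digamma (1::real) \<le> 0" "0 \<le> Digamma (2::real)"
    using euler_mascheroni_pos euler_mascheroni_less_13_over_22 by simp_all
  moreover have "continuous_on {1..2::real} Digamma"
    by (rule continuous_on_Polygamma) (auto elim!: nonpos_Ints_cases)
  ultimately obtain c :: real where "1 \<le> c" "Digamma c = 0"
    using IVT'[of Digamma "1::real" 0 2] by auto
  then show "\<exists>c::real. c > 0 \<and> Digamma c = 0"
    by (intro exI[of _ c]) simp
next
  fix c d :: real
  assume "c > 0 \<and> Digamma c = 0" "d > 0 \<and> Digamma d = 0"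
  then show "c = d"
    using Digamma_real_strict_mono[of c d] Digamma_real_strict_mono[of d c]
    by (cases c d rule: linorder_cases) auto
qed

definition psi_root :: real where
  "psi_root = (THE c. c > 0 \<and> Digamma c = 0)"

lemma psi_root: "psi_root > 0" "Digamma psi_root = 0"
  using theI'[OF ex1_Digamma_pos_root] by (simp_all add: psi_root_def)

lemma psi_root_unique: "c > 0 \<Longrightarrow> Digamma c = 0 \<Longrightarrow> c = psi_root"
  using ex1_Digamma_pos_root psi_root by blast

definition psi_approx :: "real \<Rightarrow> real \<Rightarrow> real" where
  "psi_approx a x = ln (x + a) - 1 / x"

definition psi_error :: "real \<Rightarrow> real \<Rightarrow> real" where
  "psi_error a x = Digamma x - psi_approx a x"

end

theory Submission
  imports Defs "HOL-Real_Asymp.Real_Asymp"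
begin

text \<open>
  Since \<open>Digamma (x + 1) = Digamma x + 1 / x\<close>, the error \<open>psi_error a x\<close> is
  \<open>Digamma (x + 1) - ln (x + a)\<close>, so the theorem amounts to the enclosure
  \<open>ln (x + 1/2) \<le> Digamma (x + 1) \<le> ln (x + exp (- \<gamma>))\<close> for \<open>x > 0\<close>: as \<open>a\<close> lies between
  \<open>1/2\<close> and \<open>exp (- \<gamma>)\<close>, the error and its negative are then at most
  \<open>ln ((x + exp (- \<gamma>)) / (x + 1/2))\<close>. This is part (2) with constant 1, and part (1) follows
  because that expression decreases in \<open>x\<close>.

  The lower bound holds because the difference of its two sides tends to 0 along
  \<open>x, x + 1, x + 2, \<dots>\<close> and decreases at each step, by the recurrence and a logarithm estimate.

  The upper bound is an equality at \<open>x = 0\<close>, where \<open>Digamma 1 = - \<gamma>\<close>, and what makes it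
  persist is that \<open>exp (Digamma x)\<close> has slope at most 1 (\<open>Polygamma_1_mult_exp_Digamma_le_1\<close>).
  That slope, \<open>Polygamma 1 x * exp (Digamma x)\<close>, tends to 1 at infinity, and it is monotone
  because its derivative has the sign of \<open>(Polygamma 1 x)\<^sup>2 + Polygamma 2 x\<close>. The last
  quantity is nonnegative (\<open>Polygamma_1_squared_plus_Polygamma_2_nonneg\<close>), again by comparing
  arguments that differ by 1.
\<close>

section \<open>Comparison along unit steps\<close>

text \<open>
  A unit shift changes a polygamma value by a rational term. When \<open>g\<close> compares a polygamma
  function with an elementary one, the polygamma values thus cancel from \<open>g y - g (y + 1)\<close>, and
  the first hypothesis becomes an elementary inequality.
\<close>

lemma nonneg_if_decreasing_by_unit_steps:
  fixes g :: "real \<Rightarrow> real"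
  assumes "\<And>y. y \<ge> x \<Longrightarrow> g (y + 1) \<le> g y"
    and "(\<lambda>n. g (x + real n)) \<longlonglongrightarrow> 0"
  shows "0 \<le> g x"
proof -
  have "decseq (\<lambda>n. g (x + real n))"
    using assms(1)[of "x + real n" for n] by (intro decseq_SucI) (simp add: add_ac)
  from decseq_ge[OF this assms(2), of 0] show ?thesis
    by simp
qed

lemma tendsto_Digamma_minus_ln_shift:
  fixes x a :: real
  assumes "x > 0"
  shows "(\<lambda>n. Digamma (x + real n) - ln (x + real n + a)) \<longlonglongrightarrow> 0"
proof -
  have "Digamma (x + real n) = Digamma x + (\<Sum>k<n. inverse (x + real k))" for n
    using Polygamma_plus_of_nat[of n x 0] assms by (auto simp: inverse_eq_divide)
  moreover have "(\<lambda>n. Digamma x - (ln (real n) - (\<Sum>k<n. inverse (x + real k)))) \<longlonglongrightarrow> 0"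
    using tendsto_diff[OF tendsto_const Digamma_LIMSEQ[of x], of "Digamma x"] assms by simp
  ultimately have "(\<lambda>n. Digamma (x + real n) - ln (real n)) \<longlonglongrightarrow> 0"
    by (simp add: algebra_simps)
  moreover have "(\<lambda>n. ln (real n) - ln (x + real n + a)) \<longlonglongrightarrow> 0"
    by real_asymp
  ultimately show ?thesis
    using tendsto_add by fastforce
qed

lemma tendsto_Polygamma_shift:
  fixes x :: real
  assumes "x > 0" "m > 0"
  shows "(\<lambda>n. Polygamma m (x + real n)) \<longlonglongrightarrow> 0"
proof -
  let ?c = "(- 1) ^ m * fact m :: real"
  have "(\<lambda>n. \<Sum>k<n. 1 / (x + real k) ^ Suc m) \<longlonglongrightarrow> (- 1) ^ Suc m * Polygamma m x / fact m"
    using Polygamma_LIMSEQ[of x m] assms by (simp add: sums_def inverse_eq_divide)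
  then have "(\<lambda>n. Polygamma m x + ?c * (\<Sum>k<n. 1 / (x + real k) ^ Suc m))
      \<longlonglongrightarrow> Polygamma m x + ?c * ((- 1) ^ Suc m * Polygamma m x / fact m)"
    by (intro tendsto_intros)
  moreover have "?c * ((- 1) ^ Suc m * Polygamma m x / fact m) = - Polygamma m x"
    by (simp add: field_simps flip: power_mult_distrib)
  moreover have "Polygamma m (x + real n) =
      Polygamma m x + ?c * (\<Sum>k<n. 1 / (x + real k) ^ Suc m)" for n
    using Polygamma_plus_of_nat[of n x m] assms by auto
  ultimately show ?thesis
    by simp
qed

section \<open>Elementary bounds for the digamma and trigamma functions\<close>

lemma Digamma_le_ln:
  fixes x :: real
  assumes "x > 0"
  shows "Digamma x \<le> ln x"
proof -
  let ?g = "\<lambda>y. ln y - Digamma y"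
  have "0 \<le> ?g x"
  proof (rule nonneg_if_decreasing_by_unit_steps[where g = ?g])
    show "?g (y + 1) \<le> ?g y" if "y \<ge> x" for y
    proof -
      have "ln (y + 1) - ln y \<le> 1 / y"
        using ln_diff_le[of "y + 1" y] that assms by simp
      then show ?thesis
        using that assms by (simp add: Digamma_plus1)
    qed
    show "(\<lambda>n. ?g (x + real n)) \<longlonglongrightarrow> 0"
      using tendsto_minus[OF tendsto_Digamma_minus_ln_shift[OF assms, of 0]] by simp
  qed
  then show ?thesis
    by simp
qed

lemma ln_le_Digamma_plus1:
  fixes x :: real
  assumes "x > 0"
  shows "ln (x + 1/2) \<le> Digamma (x + 1)"
proof -
  let ?g = "\<lambda>y. Digamma (y + 1) - ln (y + 1/2)"
  have "0 \<le> ?g x"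
  proof (rule nonneg_if_decreasing_by_unit_steps[where g = ?g])
    show "?g (y + 1) \<le> ?g y" if "y \<ge> x" for y
    proof -
      have "ln (y + 3/2) - ln (y + 1/2) \<ge> 1 / (y + 1)"
        using ln_inverse_approx_ge[of "y + 1/2" "y + 3/2"] that assms
        by (simp add: field_simps)
      then show ?thesis
        using that assms Digamma_plus1[of "y + 1"] by (simp add: add_ac)
    qed
    show "(\<lambda>n. ?g (x + real n)) \<longlonglongrightarrow> 0"
      using tendsto_Digamma_minus_ln_shift[of "x + 1" "- 1/2"] assms by (simp add: add_ac)
  qed
  then show ?thesis
    by simp
qed

lemma Polygamma_1_ge:
  fixes x :: real
  assumes "x > 0"
  shows "1 / x + 1 / (2 * x\<^sup>2) \<le> Polygamma 1 x"
proof -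
  let ?g = "\<lambda>y. Polygamma 1 y - (1 / y + 1 / (2 * y\<^sup>2))"
  have "0 \<le> ?g x"
  proof (rule nonneg_if_decreasing_by_unit_steps[where g = ?g])
    show "?g (y + 1) \<le> ?g y" if "y \<ge> x" for y
    proof -
      have "?g y - ?g (y + 1) = (1 / y - 1 / (y + 1))\<^sup>2 / 2"
        using that assms
        by (simp add: Polygamma_plus1 divide_simps) (simp add: algebra_simps power2_eq_square)
      then show ?thesis
        using zero_le_power2[of "1 / y - 1 / (y + 1)"] by linarith
    qed
    have "(\<lambda>n. 1 / (x + real n) + 1 / (2 * (x + real n)\<^sup>2)) \<longlonglongrightarrow> 0"
      by real_asymp
    from tendsto_diff[OF tendsto_Polygamma_shift[OF assms, of 1] this]
    show "(\<lambda>n. ?g (x + real n)) \<longlonglongrightarrow> 0"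
      by simp
  qed
  then show ?thesis
    by simp
qed

lemma Polygamma_1_le:
  fixes x :: real
  assumes "x > 0"
  shows "Polygamma 1 x \<le> 1 / x + 1 / x\<^sup>2"
proof -
  let ?g = "\<lambda>y. 1 / y + 1 / y\<^sup>2 - Polygamma 1 y"
  have "0 \<le> ?g x"
  proof (rule nonneg_if_decreasing_by_unit_steps[where g = ?g])
    show "?g (y + 1) \<le> ?g y" if "y \<ge> x" for y
    proof -
      have "?g y - ?g (y + 1) = 1 / (y * (y + 1)\<^sup>2)"
        using that assms
        by (simp add: Polygamma_plus1 divide_simps) (simp add: algebra_simps power2_eq_square)
      moreover have "1 / (y * (y + 1)\<^sup>2) \<ge> 0"
        using that assms by simp
      ultimately show ?thesis
        by linarith
    qed
    have "(\<lambda>n. 1 / (x + real n) + 1 / (x + real n)\<^sup>2) \<longlonglongrightarrow> 0"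
      by real_asymp
    from tendsto_diff[OF this tendsto_Polygamma_shift[OF assms, of 1]]
    show "(\<lambda>n. ?g (x + real n)) \<longlonglongrightarrow> 0"
      by simp
  qed
  then show ?thesis
    by simp
qed

section \<open>The slope of the exponential of the digamma function\<close>

text \<open>
  A unit step lowers the left-hand side by a positive multiple of
  \<open>Polygamma 1 y - 1 / y - 1 / (2 * y\<^sup>2)\<close>, because the difference of squares is linear
  in \<open>Polygamma 1 y\<close>; this is where the lower bound \<open>Polygamma_1_ge\<close> is needed.
\<close>

lemma Polygamma_1_squared_plus_Polygamma_2_nonneg:
  fixes x :: real
  assumes "x > 0"
  shows "0 \<le> (Polygamma 1 x)\<^sup>2 + Polygamma 2 x"
proof (rule nonneg_if_decreasing_by_unit_steps[where g = "\<lambda>y. (Polygamma 1 y)\<^sup>2 + Polygamma 2 y"])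
  let ?g = "\<lambda>y::real. (Polygamma 1 y)\<^sup>2 + Polygamma 2 y"
  show "?g (y + 1) \<le> ?g y" if "y \<ge> x" for y
  proof -
    have y: "y > 0"
      using that assms by simp
    have p1: "Polygamma 1 (y + 1) = Polygamma 1 y - 1 / y\<^sup>2"
      using Polygamma_plus1[of y 1] y by (simp add: numeral_2_eq_2)
    have p2: "Polygamma 2 (y + 1) = Polygamma 2 y + 2 / y ^ 3"
      using Polygamma_plus1[of y 2] y by (simp add: numeral_3_eq_3 numeral_2_eq_2)
    have "?g y - ?g (y + 1) = 2 / y\<^sup>2 * (Polygamma 1 y - (1 / y + 1 / (2 * y\<^sup>2)))"
      unfolding p1 p2 using y by (simp add: field_simps power2_eq_square power3_eq_cube)
    moreover have "\<dots> \<ge> 0"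
      using Polygamma_1_ge[OF y] by (intro mult_nonneg_nonneg) auto
    ultimately show ?thesis
      by linarith
  qed
  show "(\<lambda>n. ?g (x + real n)) \<longlonglongrightarrow> 0"
    using tendsto_add[OF tendsto_power[OF tendsto_Polygamma_shift[OF assms, of 1], of 2]
        tendsto_Polygamma_shift[OF assms, of 2]] by simp
qed

text \<open>
  The slope increases towards its limit at infinity, and the bounds \<open>Polygamma_1_le\<close> and
  \<open>Digamma_le_ln\<close> bound it by \<open>1 + 1 / y\<close> at every \<open>y\<close>, so the limit is at most 1.
\<close>

lemma Polygamma_1_mult_exp_Digamma_le_1:
  fixes x :: real
  assumes "x > 0"
  shows "Polygamma 1 x * exp (Digamma x) \<le> 1"
proof (rule tendsto_lowerbound)
  let ?s = "\<lambda>y::real. Polygamma 1 y * exp (Digamma y)"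
  have mono: "?s x \<le> ?s y" if "x \<le> y" for y
  proof (rule DERIV_nonneg_imp_nondecreasing[OF that])
    fix t assume "x \<le> t" "t \<le> y"
    then have t: "t > 0"
      using assms by simp
    then have "(?s has_real_derivative exp (Digamma t) * ((Polygamma 1 t)\<^sup>2 + Polygamma 2 t)) (at t)"
      by (auto intro!: derivative_eq_intros elim!: nonpos_Ints_cases
          simp: algebra_simps power2_eq_square eval_nat_numeral)
    moreover have "exp (Digamma t) * ((Polygamma 1 t)\<^sup>2 + Polygamma 2 t) \<ge> 0"
      using Polygamma_1_squared_plus_Polygamma_2_nonneg[OF t] by simp
    ultimately show "\<exists>d. (?s has_real_derivative d) (at t) \<and> d \<ge> 0"
      by blast
  qed
  have bound: "?s y \<le> 1 + 1 / y" if "y > 0" for y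
  proof -
    have "?s y \<le> (1 / y + 1 / y\<^sup>2) * exp (ln y)"
      using Polygamma_1_le[OF that] Digamma_le_ln[OF that] that
      by (intro mult_mono) (auto simp: ln_ge_iff simp del: exp_ln)
    also have "\<dots> = 1 + 1 / y"
      using that by (simp add: field_simps power2_eq_square)
    finally show ?thesis .
  qed
  show "eventually (\<lambda>y. ?s x \<le> 1 + 1 / y) at_top"
    using eventually_ge_at_top[of x]
  proof eventually_elim
    case (elim y)
    then show ?case
      using mono[of y] bound[of y] assms by simp
  qed
  show "((\<lambda>y::real. 1 + 1 / y) \<longlongrightarrow> 1) at_top"
    by real_asymp
qed simp

text \<open>
  By the slope bound, \<open>exp (Digamma (y + 1)) - y\<close> is nonincreasing for \<open>y \<ge> 0\<close>; the constant
  \<open>exp (- \<gamma>)\<close> is its value at 0.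
\<close>

lemma Digamma_plus1_le_ln:
  fixes x :: real
  assumes "x > 0"
  shows "Digamma (x + 1) \<le> ln (x + exp (- euler_mascheroni))"
proof -
  let ?h = "\<lambda>y::real. exp (Digamma (y + 1)) - y"
  have "?h x \<le> ?h 0"
  proof (rule DERIV_nonpos_imp_nonincreasing[where f = ?h])
    fix t :: real assume "0 \<le> t" "t \<le> x"
    then have "(?h has_real_derivative Polygamma 1 (t + 1) * exp (Digamma (t + 1)) - 1) (at t)"
      by (auto intro!: derivative_eq_intros DERIV_chain2[OF has_field_derivative_Polygamma]
          elim!: nonpos_Ints_cases)
    moreover have "Polygamma 1 (t + 1) * exp (Digamma (t + 1)) - 1 \<le> 0"
      using Polygamma_1_mult_exp_Digamma_le_1[of "t + 1"] \<open>0 \<le> t\<close> by simp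
    ultimately show "\<exists>d. (?h has_real_derivative d) (at t) \<and> d \<le> 0"
      by blast
  qed (use assms in simp)
  then have "exp (Digamma (x + 1)) \<le> x + exp (- euler_mascheroni)"
    by simp
  then show ?thesis
    using assms by (subst ln_ge_iff) (auto intro: add_pos_pos)
qed

section \<open>The error of the approximation\<close>

lemma abs_psi_error_le:
  fixes x a :: real
  assumes "x > 0" "1/2 \<le> a" "a \<le> exp (- euler_mascheroni)"
  shows "\<bar>psi_error a x\<bar> \<le> ln ((x + exp (- euler_mascheroni)) / (x + 1/2))"
proof -
  let ?e = "exp (- euler_mascheroni) :: real"
  have error: "psi_error a x = Digamma (x + 1) - ln (x + a)"
    using assms by (simp add: psi_error_def psi_approx_def Digamma_plus1)
  have "ln (x + 1/2) \<le> ln (x + a)" "ln (x + a) \<le> ln (x + ?e)"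
    using assms by simp_all
  then have "\<bar>psi_error a x\<bar> \<le> ln (x + ?e) - ln (x + 1/2)"
    unfolding error
    using ln_le_Digamma_plus1[OF assms(1)] Digamma_plus1_le_ln[OF assms(1)] by linarith
  then show ?thesis
    using assms by (simp add: ln_div add_pos_pos)
qed

lemma ln_shift_quotient_antimono:
  fixes x y a b :: real
  assumes "0 < x" "x \<le> y" "0 \<le> a" "a \<le> b"
  shows "ln ((y + b) / (y + a)) \<le> ln ((x + b) / (x + a))"
proof -
  have "0 \<le> (y - x) * (b - a)"
    using assms by simp
  then have "(y + b) * (x + a) \<le> (x + b) * (y + a)"
    by (simp add: algebra_simps)
  then have "(y + b) / (y + a) \<le> (x + b) / (x + a)"
    using assms by (simp add: divide_simps)
  then show ?thesis
    using assms by simp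
qed

theorem theorem4:
  shows "(\<forall>x a :: real. x > psi_root \<longrightarrow> 1/2 < a \<longrightarrow> a < exp (- euler_mascheroni) \<longrightarrow>
            - ln ((psi_root + exp (- euler_mascheroni)) / (psi_root + 1/2)) \<le> psi_error a x \<and>
            psi_error a x \<le> ln ((psi_root + exp (- euler_mascheroni)) / (psi_root + 1/2)))
       \<and> (\<exists>K > 0. \<forall>x a :: real. x > psi_root \<longrightarrow> 1/2 < a \<longrightarrow> a < exp (- euler_mascheroni) \<longrightarrow>
            \<bar>Digamma x - (ln (x + a) - 1 / x)\<bar>
              \<le> K * \<bar>ln ((x + exp (- euler_mascheroni)) / (x + 1/2))\<bar>)"
proof (intro conjI)
  let ?e = "exp (- euler_mascheroni) :: real"
  have error: "\<bar>psi_error a x\<bar> \<le> ln ((x + ?e) / (x + 1/2))"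
    if "x > psi_root" "1/2 < a" "a < ?e" for x a
    using that psi_root(1) by (intro abs_psi_error_le) auto
  have uniform: "\<bar>psi_error a x\<bar> \<le> ln ((psi_root + ?e) / (psi_root + 1/2))"
    if "x > psi_root" "1/2 < a" "a < ?e" for x a
    using error[OF that] ln_shift_quotient_antimono[of psi_root x "1/2" ?e] that psi_root(1)
    by linarith
  show "\<forall>x a :: real. x > psi_root \<longrightarrow> 1/2 < a \<longrightarrow> a < ?e \<longrightarrow>
      - ln ((psi_root + ?e) / (psi_root + 1/2)) \<le> psi_error a x \<and>
      psi_error a x \<le> ln ((psi_root + ?e) / (psi_root + 1/2))"
    using uniform by (simp add: abs_le_iff minus_le_iff)
  show "\<exists>K > 0. \<forall>x a :: real. x > psi_root \<longrightarrow> 1/2 < a \<longrightarrow> a < ?e \<longrightarrow>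
      \<bar>Digamma x - (ln (x + a) - 1 / x)\<bar> \<le> K * \<bar>ln ((x + ?e) / (x + 1/2))\<bar>"
  proof (intro exI[of _ 1] conjI allI impI)
    fix x a :: real
    assume "x > psi_root" "1/2 < a" "a < ?e"
    from error[OF this]
    show "\<bar>Digamma x - (ln (x + a) - 1 / x)\<bar> \<le> 1 * \<bar>ln ((x + ?e) / (x + 1/2))\<bar>"
      by (simp add: psi_error_def psi_approx_def)
  qed simp
qed

end
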